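(* Let $a<b$, let $K\ge 1$ be an integer, let $V$ be a compact subset of $C[a,b]$, let $\boldsymbol{s_0}\in\mathbb{R}^K$, and let $\boldsymbol{g}(\boldsymbol{s},u,x)\in\mathbb{R}^K$ be the right-hand side of the ODE system $\frac{d}{dx}\boldsymbol{s}(x)=\boldsymbol{g}(\boldsymbol{s}(x),u(x),x)$, $\boldsymbol{s}(a)=\boldsymbol{s_0}$, on $[a,b]$. Let $W\subset C[a,b]$ be the set consisting of $V$ and all piecewise linear interpolants of elements of $V$ on uniform grids (defined in the context), and let $G:W\to C([a,b];\mathbb{R}^K)$ be the continuous solution operator, $(Gu)(x)=\boldsymbol{s_0}+\int_a^x \boldsymbol{g}((Gu)(t),u(t),t)\,dt$ for all $u\in W$, $x\in[a,b]$. Assume that $\boldsymbol{g}$ is Lipschitz with respect to $\boldsymbol{s}$ and $u$ on $G(W)\times W$ with constant $c>0$ (as specified in the context). Let $\sigma:\mathbb{R}\to\mathbb{R}$ be a continuous non-polynomial function, applied componentwise to vectors. Let $\kappa(m,V)$, $m=1,2,\dots$, be constants such that $\max_{x\in[a,b]}|u(x)-u_m(x)|\le\kappa(m,V)$ for all $u\in V$ and all $m$, and $\kappa(m,V)\to 0$ as $m\to\infty$, where $u_m=\mathcal{L}_m(u)$ is the piecewise linear interpolant of $u$ at the points $x_j=a+j(b-a)/m$, $j=0,\dots,m$. Let $\varepsilon>0$ and suppose that $m$ is a positive integer such that $c(b-a)\kappa(m,V)e^{c(b-a)}<\varepsilon$. Then for any $d\in[a,b]$ there exist a positive integer $n$ and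 $\mathcal{W}_1\in\mathbb{R}^{n\times(m+1)}$, $b_1\in\mathbb{R}^{n}$, $\mathcal{W}_2\in\mathbb{R}^{K\times n}$, $b_2\in\mathbb{R}^K$ such that $$\left\|(Gu)(d)-\left(\mathcal{W}_2\cdot\sigma\left(\mathcal{W}_1\cdot[u(x_0)\ \cdots\ u(x_m)]^T+b_1\right)+b_2\right)\right\|_2<\varepsilon$$ holds for all $u\in V$.
   Context: $C[a,b]$ is the space of continuous real-valued functions on $[a,b]$ with the sup-norm; $C([a,b];\mathbb{R}^K)$ is its $\mathbb{R}^K$-valued analogue. For a positive integer $m$, let $x_j=a+j(b-a)/m$, $j=0,1,\dots,m$. For $u\in C[a,b]$, $\mathcal{L}_m(u)=u_m$ is the function $$u_m(x)=u(x_j)+\frac{u(x_{j+1})-u(x_j)}{x_{j+1}-x_j}(x-x_j),\quad x_j\le x\le x_{j+1},\ j=0,\dots,m-1.$$ Set $U_m=\{\mathcal{L}_m(u): u\in V\}$, $W_m=V\cup U_m$, and $W=\bigcup_{i=1}^{\infty}W_i$. Lipschitz condition of $\boldsymbol{g}$ on $G(W)\times W$ with constant $c>0$: $$\|\boldsymbol{g}(\boldsymbol{s_1},u,x)-\boldsymbol{g}(\boldsymbol{s_2},u,x)\|_2\le c\|\boldsymbol{s_1}-\boldsymbol{s_2}\|_2,\qquad \|\boldsymbol{g}(\boldsymbol{s},u_1,x)-\boldsymbol{g}(\boldsymbol{s},u_2,x)\|_2\le c|u_1-u_2|$$ for all $x\in[a,b]$, all $\boldsymbol{s},\boldsymbol{s_1},\boldsymbol{s_2}\in\{h(x):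 h\in G(W)\}\subset\mathbb{R}^K$ and all $u,u_1,u_2\in\{w(x): w\in W\}\subset\mathbb{R}$. *)

theory Defs
  imports "HOL-Analysis.Analysis" "HOL-Computational_Algebra.Polynomial"
begin

text \<open>
  Elements of \<open>C_space a b\<close> are extensional functions on \<open>{a..b}\<close>, i.e. \<open>undefined\<close> outside; its
  distance is the supremum over \<open>{a..b}\<close> of \<open>dist\<close>, which on \<open>real ^ 'k\<close> is the Euclidean one.
\<close>
definition C_space :: "real \<Rightarrow> real \<Rightarrow> (real \<Rightarrow> 'b::metric_space) metric" where
  "C_space a b = cfunspace (top_of_set {a..b}) euclidean_metric"

definition grid :: "real \<Rightarrow> real \<Rightarrow> nat \<Rightarrow> nat \<Rightarrow> real" where
  "grid a b m j = a + real j * (b - a) / real m"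

text \<open>
  The index \<open>j\<close> selects a cell \<open>[x_j, x_{j+1}]\<close> containing \<open>x\<close>. At an interior node two cells
  qualify, and lemma \<open>lin_interp_cell\<close> below shows that the choice does not matter.
\<close>
definition lin_interp :: "real \<Rightarrow> real \<Rightarrow> nat \<Rightarrow> (real \<Rightarrow> real) \<Rightarrow> real \<Rightarrow> real" where
  "lin_interp a b m u = (\<lambda>x\<in>{a..b}.
     let j = (LEAST j. x \<le> grid a b m (Suc j)); x0 = grid a b m j; x1 = grid a b m (Suc j)
     in u x0 + (u x1 - u x0) / (x1 - x0) * (x - x0))"

definition U_set :: "real \<Rightarrow> real \<Rightarrow> (real \<Rightarrow> real) set \<Rightarrow> nat \<Rightarrow> (real \<Rightarrow> real) set" where
  "U_set a b V m = lin_interp a b m ` V"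

definition W_level :: "real \<Rightarrow> real \<Rightarrow> (real \<Rightarrow> real) set \<Rightarrow> nat \<Rightarrow> (real \<Rightarrow> real) set" where
  "W_level a b V m = V \<union> U_set a b V m"

definition W_set :: "real \<Rightarrow> real \<Rightarrow> (real \<Rightarrow> real) set \<Rightarrow> (real \<Rightarrow> real) set" where
  "W_set a b V = (\<Union>i\<in>{1..}. W_level a b V i)"

text \<open>
  The integral is the Henstock--Kurzweil one, which covers Riemann and Lebesgue
  integrable integrands; integrability is required because \<open>integral\<close> is 0 otherwise.
\<close>
definition solution_operator ::
    "real \<Rightarrow> real \<Rightarrow> (real \<Rightarrow> real) set \<Rightarrow> (real ^ 'k \<Rightarrow> real \<Rightarrow> real \<Rightarrow> real ^ 'k) \<Rightarrow> real ^ 'k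
      \<Rightarrow> ((real \<Rightarrow> real) \<Rightarrow> real \<Rightarrow> real ^ 'k) \<Rightarrow> bool" where
  "solution_operator a b W g s0 G \<longleftrightarrow>
     (\<forall>u\<in>W. \<forall>x\<in>{a..b}.
        (\<lambda>t. g (G u t) (u t) t) integrable_on {a..x} \<and>
        G u x = s0 + integral {a..x} (\<lambda>t. g (G u t) (u t) t))"

definition lipschitz_on_range ::
    "real \<Rightarrow> real \<Rightarrow> (real \<Rightarrow> real) set \<Rightarrow> (real ^ 'k \<Rightarrow> real \<Rightarrow> real \<Rightarrow> real ^ 'k)
      \<Rightarrow> ((real \<Rightarrow> real) \<Rightarrow> real \<Rightarrow> real ^ 'k) \<Rightarrow> real \<Rightarrow> bool" where
  "lipschitz_on_range a b W g G c \<longleftrightarrow>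
     (\<forall>x\<in>{a..b}.
        (\<forall>s1\<in>{h x |h. h \<in> G ` W}. \<forall>s2\<in>{h x |h. h \<in> G ` W}. \<forall>u\<in>{w x |w. w \<in> W}.
           norm (g s1 u x - g s2 u x) \<le> c * norm (s1 - s2)) \<and>
        (\<forall>s\<in>{h x |h. h \<in> G ` W}. \<forall>u1\<in>{w x |w. w \<in> W}. \<forall>u2\<in>{w x |w. w \<in> W}.
           norm (g s u1 x - g s u2 x) \<le> c * \<bar>u1 - u2\<bar>))"

text \<open>
  The value \<open>W2 \<sigma>(W1 v + b1) + b2\<close> for \<open>v\<close> in \<open>p\<close>-dimensional space, with hidden width \<open>n\<close>.
  The sizes \<open>n\<close> and \<open>p\<close> are not fixed by types, so matrices and vectors are functions of indices
  of which only those in \<open>{..<n}\<close> and \<open>{..<p}\<close> are read; entries outside are irrelevant.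
\<close>
definition shallow_net ::
    "(real \<Rightarrow> real) \<Rightarrow> nat \<Rightarrow> nat \<Rightarrow> (nat \<Rightarrow> nat \<Rightarrow> real) \<Rightarrow> (nat \<Rightarrow> real)
      \<Rightarrow> ('k \<Rightarrow> nat \<Rightarrow> real) \<Rightarrow> real ^ 'k \<Rightarrow> (nat \<Rightarrow> real) \<Rightarrow> real ^ 'k" where
  "shallow_net \<sigma> n p W1 b1 W2 b2 v =
     (\<chi> k. (\<Sum>i<n. W2 k i * \<sigma> ((\<Sum>j<p. W1 i j * v j) + b1 i))) + b2"

lemma grid_strict_mono:
  assumes "a < b" "0 < m" "i < j"
  shows "grid a b m i < grid a b m j"
  using assms by (simp add: grid_def divide_strict_right_mono)

lemma grid_mono:
  assumes "a < b" "0 < m" "i \<le> j"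
  shows "grid a b m i \<le> grid a b m j"
  using assms by (simp add: grid_def divide_right_mono)

lemma grid_0: "grid a b m 0 = a"
  by (simp add: grid_def)

lemma grid_m: "0 < m \<Longrightarrow> grid a b m m = b"
  by (simp add: grid_def)

lemma lin_interp_cell:
  assumes ab: "a < b" and j: "j < m"
    and x: "grid a b m j \<le> x" "x \<le> grid a b m (Suc j)"
  shows "lin_interp a b m u x =
    u (grid a b m j) + (u (grid a b m (Suc j)) - u (grid a b m j)) /
      (grid a b m (Suc j) - grid a b m j) * (x - grid a b m j)"
proof -
  have m: "0 < m" using j by simp
  have xab: "x \<in> {a..b}"
    using grid_mono[OF ab m, of 0 j] grid_mono[OF ab m, of "Suc j" m] j x
    by (simp add: grid_0 grid_m[OF m])
  define i where "i = (LEAST i. x \<le> grid a b m (Suc i))"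
  have i1: "x \<le> grid a b m (Suc i)" and i2: "i \<le> j"
    unfolding i_def using x(2) by (auto intro: LeastI Least_le)
  have val: "lin_interp a b m u x =
    u (grid a b m i) + (u (grid a b m (Suc i)) - u (grid a b m i)) /
      (grid a b m (Suc i) - grid a b m i) * (x - grid a b m i)"
    using xab by (simp add: lin_interp_def Let_def i_def)
  show ?thesis
  proof (cases "i = j")
    case True
    then show ?thesis using val by simp
  next
    case False
    then have ij: "Suc i \<le> j" using i2 by simp
    have xj: "x = grid a b m j" and xi: "x = grid a b m (Suc i)"
      using grid_mono[OF ab m ij] i1 x(1) by auto
    have "grid a b m i < grid a b m (Suc i)" using grid_strict_mono[OF ab m] by simp
    then show ?thesis using val xj xi by simp
  qed
qed

lemma grid_cover:
  assumes ab: "a < b" and m: "0 < m"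
  shows "{a..b} = (\<Union>j\<in>{..<m}. {grid a b m j..grid a b m (Suc j)})"
proof
  show "(\<Union>j\<in>{..<m}. {grid a b m j..grid a b m (Suc j)}) \<subseteq> {a..b}"
  proof
    fix x assume "x \<in> (\<Union>j\<in>{..<m}. {grid a b m j..grid a b m (Suc j)})"
    then obtain j where "j < m" "grid a b m j \<le> x" "x \<le> grid a b m (Suc j)" by auto
    then show "x \<in> {a..b}"
      using grid_mono[OF ab m, of 0 j] grid_mono[OF ab m, of "Suc j" m]
      by (simp add: grid_0 grid_m[OF m])
  qed
  show "{a..b} \<subseteq> (\<Union>j\<in>{..<m}. {grid a b m j..grid a b m (Suc j)})"
  proof
    fix x assume x: "x \<in> {a..b}"
    define i where "i = (LEAST i. x \<le> grid a b m (Suc i))"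
    have le: "x \<le> grid a b m (Suc (m - 1))" using x m by (simp add: grid_m)
    have i1: "x \<le> grid a b m (Suc i)" and i2: "i \<le> m - 1"
      unfolding i_def using le by (rule LeastI, rule Least_le)
    have "grid a b m i \<le> x"
    proof (cases i)
      case 0
      then show ?thesis using x by (simp add: grid_0)
    next
      case (Suc k)
      then have "\<not> x \<le> grid a b m (Suc k)"
        using not_less_Least[of k "\<lambda>i. x \<le> grid a b m (Suc i)"] by (simp add: i_def)
      then show ?thesis using Suc by simp
    qed
    then show "x \<in> (\<Union>j\<in>{..<m}. {grid a b m j..grid a b m (Suc j)})"
      using i1 i2 m by (auto intro!: bexI[of _ i])
  qed
qed

lemma in_C_space_iff:
  fixes u :: "real \<Rightarrow> 'b::metric_space"
  shows "u \<in> mspace (C_space a b) \<longleftrightarrow> u \<in> extensional {a..b} \<and> continuous_on {a..b} u"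
  by (auto simp: C_space_def compactin_mspace_cfunspace compactin_subtopology
      simp del: mspace_cfunspace)

lemma lin_interp_in_C_space:
  assumes ab: "a < b" and m: "0 < m"
  shows "lin_interp a b m u \<in> mspace (C_space a b)"
proof -
  have "continuous_on {grid a b m j..grid a b m (Suc j)} (lin_interp a b m u)" if "j < m" for j
  proof -
    have "continuous_on {grid a b m j..grid a b m (Suc j)} (\<lambda>x.
       u (grid a b m j) + (u (grid a b m (Suc j)) - u (grid a b m j)) /
      (grid a b m (Suc j) - grid a b m j) * (x - grid a b m j))"
      by (intro continuous_intros)
    then show ?thesis
      by (rule continuous_on_eq) (simp add: lin_interp_cell[OF ab that])
  qed
  then have "continuous_on {a..b} (lin_interp a b m u)"
    unfolding grid_cover[OF ab m] by (intro continuous_on_closed_Union) auto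
  then show ?thesis by (simp add: in_C_space_iff lin_interp_def)
qed

lemma W_set_subset_C_space:
  assumes "a < b" "V \<subseteq> mspace (C_space a b)"
  shows "W_set a b V \<subseteq> mspace (C_space a b)"
  using assms lin_interp_in_C_space by (auto simp: W_set_def W_level_def U_set_def)

end

theory Submission
  imports Defs
begin

text \<open>
  By Gronwall's inequality, replacing \<open>u\<close> by its interpolant \<open>u_m\<close> moves \<open>(Gu)(d)\<close> by at most
  \<open>c (b - a) \<kappa>(m,V) exp (c (b - a))\<close>. Since \<open>u_m\<close> depends only on the nodal values of \<open>u\<close>, the number
  \<open>(Gu_m)(d)\<close> is a continuous function of the nodal vector, which ranges over a compact set, so the
  strictly positive remainder of \<open>\<epsilon>\<close> is left for universal approximation.

  Universal approximation: exponentials of linear forms are dense by Stone--Weierstrass, so it is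
  enough to approximate \<open>exp\<close>, hence the monomials, by combinations of \<open>t \<mapsto> \<sigma>(l t + b)\<close> on compact
  intervals. If \<open>t\<^sup>j f(l t + b)\<close> is approximable for all \<open>l\<close>, \<open>b\<close>, then so is the same expression with
  \<open>f\<close> replaced by its moving integral over windows of length \<open>h\<close>; differentiating that one in \<open>l\<close>
  yields \<open>t\<^sup>j\<^sup>+\<^sup>1 (\<Delta>\<^sub>h f)(l t + b)\<close>. Starting from \<open>\<sigma>\<close> and putting \<open>l = 0\<close>, one gets
  \<open>t\<^sup>k (\<Delta>\<^sub>h\<^sup>k \<sigma>)(b)\<close>, and a continuous function all of whose \<open>k\<close>-th differences vanish is a polynomial.
\<close>

section \<open>Uniform closure of a linear span\<close>

text \<open>Coefficients are indexed by the generators themselves, so a finite linear combination is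
  a finite subset of \<open>B\<close> with a weight function. Closeness is only required on
  \<open>K\<close>, so values outside \<open>K\<close> do not matter.\<close>

definition span_closure :: "('x \<Rightarrow> real) set \<Rightarrow> 'x set \<Rightarrow> ('x \<Rightarrow> real) set" where
  "span_closure B K =
     {f. \<forall>e>0. \<exists>P C. finite P \<and> P \<subseteq> B \<and> (\<forall>x\<in>K. \<bar>f x - (\<Sum>p\<in>P. C p * p x)\<bar> < e)}"

lemma span_closureI:
  assumes "\<And>e. e > 0 \<Longrightarrow> \<exists>P C. finite P \<and> P \<subseteq> B \<and> (\<forall>x\<in>K. \<bar>f x - (\<Sum>p\<in>P. C p * p x)\<bar> < e)"
  shows "f \<in> span_closure B K"
  using assms by (auto simp: span_closure_def)

lemma span_closureE:
  assumes "f \<in> span_closure B K" "e > 0"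
  obtains P C where "finite P" "P \<subseteq> B" "\<And>x. x \<in> K \<Longrightarrow> \<bar>f x - (\<Sum>p\<in>P. C p * p x)\<bar> < e"
proof -
  have "\<exists>P C. finite P \<and> P \<subseteq> B \<and> (\<forall>x\<in>K. \<bar>f x - (\<Sum>p\<in>P. C p * p x)\<bar> < e)"
    using assms by (simp add: span_closure_def)
  then show ?thesis using that by blast
qed

lemma span_closure_limit:
  assumes "\<And>e. e > 0 \<Longrightarrow> \<exists>g\<in>span_closure B K. \<forall>x\<in>K. \<bar>f x - g x\<bar> < e"
  shows "f \<in> span_closure B K"
proof (rule span_closureI)
  fix e :: real assume "e > 0"
  then have e2: "e / 2 > 0" by simp
  obtain g where g: "g \<in> span_closure B K" "\<And>x. x \<in> K \<Longrightarrow> \<bar>f x - g x\<bar> < e / 2"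
    using assms[OF e2] by blast
  obtain P C where PC: "finite P" "P \<subseteq> B" "\<And>x. x \<in> K \<Longrightarrow> \<bar>g x - (\<Sum>p\<in>P. C p * p x)\<bar> < e / 2"
    using span_closureE[OF g(1) e2] by blast
  have "\<bar>f x - (\<Sum>p\<in>P. C p * p x)\<bar> < e" if "x \<in> K" for x
    using g(2)[OF that] PC(3)[OF that] by linarith
  with PC(1,2) show "\<exists>P C. finite P \<and> P \<subseteq> B \<and> (\<forall>x\<in>K. \<bar>f x - (\<Sum>p\<in>P. C p * p x)\<bar> < e)"
    by blast
qed

lemma span_closure_zero: "(\<lambda>x. 0) \<in> span_closure B K"
  by (rule span_closureI, rule exI[of _ "{}"]) auto

lemma span_closure_base:
  assumes "p \<in> B"
  shows "p \<in> span_closure B K"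
  by (rule span_closureI, rule exI[of _ "{p}"], rule exI[of _ "\<lambda>_. 1"]) (use assms in auto)

lemma span_closure_add:
  assumes f: "f \<in> span_closure B K" and g: "g \<in> span_closure B K"
  shows "(\<lambda>x. f x + g x) \<in> span_closure B K"
proof (rule span_closureI)
  fix e :: real assume "e > 0"
  then have e2: "e / 2 > 0" by simp
  obtain P C where P: "finite P" "P \<subseteq> B" "\<And>x. x \<in> K \<Longrightarrow> \<bar>f x - (\<Sum>p\<in>P. C p * p x)\<bar> < e / 2"
    using span_closureE[OF f e2] by blast
  obtain Q D where Q: "finite Q" "Q \<subseteq> B" "\<And>x. x \<in> K \<Longrightarrow> \<bar>g x - (\<Sum>p\<in>Q. D p * p x)\<bar> < e / 2"
    using span_closureE[OF g e2] by blast
  define A where "A p = (if p \<in> P then C p else 0) + (if p \<in> Q then D p else 0)" for p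
  have "(\<Sum>p\<in>P \<union> Q. A p * p x) = (\<Sum>p\<in>P. C p * p x) + (\<Sum>p\<in>Q. D p * p x)" for x
  proof -
    have "(\<Sum>p\<in>P \<union> Q. A p * p x) =
        (\<Sum>p\<in>P \<union> Q. if p \<in> P then C p * p x else 0) + (\<Sum>p\<in>P \<union> Q. if p \<in> Q then D p * p x else 0)"
      unfolding sum.distrib[symmetric] by (rule sum.cong) (auto simp: A_def algebra_simps)
    also have "(\<Sum>p\<in>P \<union> Q. if p \<in> P then C p * p x else 0) = (\<Sum>p\<in>P. C p * p x)"
      using P(1) Q(1) by (intro sum.mono_neutral_cong_right) auto
    also have "(\<Sum>p\<in>P \<union> Q. if p \<in> Q then D p * p x else 0) = (\<Sum>p\<in>Q. D p * p x)"
      using P(1) Q(1) by (intro sum.mono_neutral_cong_right) auto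
    finally show ?thesis .
  qed
  moreover have "\<bar>f x + g x - ((\<Sum>p\<in>P. C p * p x) + (\<Sum>p\<in>Q. D p * p x))\<bar> < e" if "x \<in> K" for x
    using P(3)[OF that] Q(3)[OF that] by linarith
  ultimately show "\<exists>P C. finite P \<and> P \<subseteq> B \<and> (\<forall>x\<in>K. \<bar>f x + g x - (\<Sum>p\<in>P. C p * p x)\<bar> < e)"
    using P(1,2) Q(1,2) by (intro exI[of _ "P \<union> Q"] exI[of _ A]) auto
qed

lemma span_closure_scale:
  assumes f: "f \<in> span_closure B K"
  shows "(\<lambda>x. c * f x) \<in> span_closure B K"
proof (rule span_closureI)
  fix e :: real assume e: "e > 0"
  then have e2: "e / (\<bar>c\<bar> + 1) > 0" by (simp add: divide_pos_pos add_nonneg_pos)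
  obtain P C where P: "finite P" "P \<subseteq> B"
      "\<And>x. x \<in> K \<Longrightarrow> \<bar>f x - (\<Sum>p\<in>P. C p * p x)\<bar> < e / (\<bar>c\<bar> + 1)"
    using span_closureE[OF f e2] by blast
  have "\<bar>c * f x - (\<Sum>p\<in>P. (c * C p) * p x)\<bar> < e" if "x \<in> K" for x
  proof -
    have "\<bar>c * f x - (\<Sum>p\<in>P. (c * C p) * p x)\<bar> = \<bar>c\<bar> * \<bar>f x - (\<Sum>p\<in>P. C p * p x)\<bar>"
      by (simp add: mult.assoc flip: sum_distrib_left right_diff_distrib abs_mult)
    also have "\<dots> \<le> \<bar>c\<bar> * (e / (\<bar>c\<bar> + 1))"
      using P(3)[OF that] by (intro mult_left_mono) auto
    also have "\<dots> < e" using e by (simp add: field_simps)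
    finally show ?thesis .
  qed
  with P(1,2) show "\<exists>P C. finite P \<and> P \<subseteq> B \<and> (\<forall>x\<in>K. \<bar>c * f x - (\<Sum>p\<in>P. C p * p x)\<bar> < e)"
    by (intro exI[of _ P] exI[of _ "\<lambda>p. c * C p"]) auto
qed

lemma span_closure_sum:
  assumes "\<And>i. i \<in> I \<Longrightarrow> f i \<in> span_closure B K"
  shows "(\<lambda>x. \<Sum>i\<in>I. c i * f i x) \<in> span_closure B K"
  using assms
proof (induction I rule: infinite_finite_induct)
  case (insert i I)
  then have "(\<lambda>x. c i * f i x + (\<Sum>i\<in>I. c i * f i x)) \<in> span_closure B K"
    by (intro span_closure_add span_closure_scale) auto
  with insert.hyps show ?case by simp
qed (simp_all add: span_closure_zero)

text \<open>Pulling back along \<open>\<phi>\<close> and multiplying by the bounded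
  \<open>\<psi>\<close> turns a uniform error on \<open>K\<close> into one on \<open>L\<close> at
  most \<open>\<bar>M\<bar>\<close> times as large. Hence membership need only be checked on
  generators. Taking \<open>\<phi>\<close> the identity gives multiplication,
  \<open>\<psi> = 1\<close> gives composition.\<close>

lemma span_closure_weighted_compose:
  assumes f: "f \<in> span_closure B K" and \<phi>: "\<phi> ` L \<subseteq> K"
    and bound: "\<And>x. x \<in> L \<Longrightarrow> \<bar>\<psi> x\<bar> \<le> M"
    and base: "\<And>p. p \<in> B \<Longrightarrow> (\<lambda>x. \<psi> x * p (\<phi> x)) \<in> span_closure B' L"
  shows "(\<lambda>x. \<psi> x * f (\<phi> x)) \<in> span_closure B' L"
proof (rule span_closure_limit)
  fix e :: real assume e: "e > 0"
  \<comment> \<open>The bound \<open>M\<close> may be zero, or even negative if \<open>L\<close> is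
    empty; \<open>\<bar>M\<bar> + 1\<close> is a safe positive divisor.\<close>
  then have e2: "e / (\<bar>M\<bar> + 1) > 0" by (simp add: divide_pos_pos add_nonneg_pos)
  obtain P C where P: "finite P" "P \<subseteq> B"
      "\<And>x. x \<in> K \<Longrightarrow> \<bar>f x - (\<Sum>p\<in>P. C p * p x)\<bar> < e / (\<bar>M\<bar> + 1)"
    using span_closureE[OF f e2] by blast
  let ?g = "\<lambda>x. \<Sum>p\<in>P. C p * (\<psi> x * p (\<phi> x))"
  have "?g \<in> span_closure B' L"
    by (rule span_closure_sum) (use base P(2) in auto)
  moreover have "\<bar>\<psi> x * f (\<phi> x) - ?g x\<bar> < e" if x: "x \<in> L" for x
  proof -
    have "?g x = \<psi> x * (\<Sum>p\<in>P. C p * p (\<phi> x))"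
      by (simp add: sum_distrib_left mult.left_commute)
    then have "\<bar>\<psi> x * f (\<phi> x) - ?g x\<bar> = \<bar>\<psi> x\<bar> * \<bar>f (\<phi> x) - (\<Sum>p\<in>P. C p * p (\<phi> x))\<bar>"
      by (simp flip: right_diff_distrib abs_mult)
    also have "\<dots> \<le> \<bar>M\<bar> * (e / (\<bar>M\<bar> + 1))"
      using P(3)[of "\<phi> x"] bound[OF x] \<phi> x by (intro mult_mono) auto
    also have "\<dots> < e" using e by (simp add: field_simps)
    finally show ?thesis .
  qed
  ultimately show "\<exists>g\<in>span_closure B' L. \<forall>x\<in>L. \<bar>\<psi> x * f (\<phi> x) - g x\<bar> < e"
    by (intro bexI[of _ ?g] ballI)
qed

lemma span_closure_compose:
  assumes "f \<in> span_closure B K" "\<phi> ` L \<subseteq> K"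
    and "\<And>p. p \<in> B \<Longrightarrow> (\<lambda>x. p (\<phi> x)) \<in> span_closure B' L"
  shows "(\<lambda>x. f (\<phi> x)) \<in> span_closure B' L"
  using span_closure_weighted_compose[of f B K \<phi> L "\<lambda>_. 1" 1 B'] assms by simp

text \<open>Only products of generators have to stay in \<open>B\<close>; sums and limits are
  supplied by the closure.\<close>

lemma span_closure_Stone_Weierstrass:
  fixes B :: "('x::t2_space \<Rightarrow> real) set"
  assumes K: "compact K"
    and cont: "\<And>p. p \<in> B \<Longrightarrow> continuous_on K p"
    and unit: "(\<lambda>x. 1) \<in> B"
    and mult: "\<And>p q. p \<in> B \<Longrightarrow> q \<in> B \<Longrightarrow> (\<lambda>x. p x * q x) \<in> B"
    and sep: "\<And>x y. x \<in> K \<Longrightarrow> y \<in> K \<Longrightarrow> x \<noteq> y \<Longrightarrow> \<exists>p\<in>B. p x \<noteq> p y"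
    and f: "continuous_on K f"
  shows "f \<in> span_closure B K"
proof -
  let ?U = "span_closure B K"
  \<comment> \<open>\<open>R\<close> consists of the continuous multipliers of \<open>?U\<close>.
    Multipliers form a ring almost by definition, which avoids expanding products of two linear
    combinations.\<close>
  define R where "R = {f. continuous_on K f \<and> (\<forall>h\<in>?U. (\<lambda>x. f x * h x) \<in> ?U)}"
  have BR: "p \<in> R" if p: "p \<in> B" for p
  proof -
    have "compact (p ` K)" using K cont[OF p] by (rule compact_continuous_image[rotated])
    then obtain M where "\<And>x. x \<in> K \<Longrightarrow> \<bar>p x\<bar> \<le> M"
      using compact_imp_bounded by (fastforce simp: bounded_iff)
    then have "(\<lambda>x. p x * h x) \<in> ?U" if h: "h \<in> ?U" for h
      using span_closure_weighted_compose[of h B K "\<lambda>x. x" K p M B, OF h] p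
      by (simp add: span_closure_base mult)
    with cont[OF p] show ?thesis by (simp add: R_def)
  qed
  interpret function_ring_on R K
  proof
    show "compact K" by fact
    show "continuous_on K f" if "f \<in> R" for f using that by (simp add: R_def)
    show "(\<lambda>x. f x + g x) \<in> R" if "f \<in> R" "g \<in> R" for f g
    proof -
      have "(\<lambda>x. f x * h x + g x * h x) \<in> ?U" if "h \<in> ?U" for h
        using \<open>f \<in> R\<close> \<open>g \<in> R\<close> that by (intro span_closure_add) (simp_all add: R_def)
      with that show ?thesis by (simp add: R_def distrib_right continuous_on_add)
    qed
    show "(\<lambda>x. f x * g x) \<in> R" if "f \<in> R" "g \<in> R" for f g
    proof -
      have "(\<lambda>x. f x * (g x * h x)) \<in> ?U" if h: "h \<in> ?U" for h
      proof -
        have "(\<lambda>x. g x * h x) \<in> ?U" using \<open>g \<in> R\<close> h by (simp add: R_def)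
        then show ?thesis using \<open>f \<in> R\<close> by (simp add: R_def)
      qed
      with that show ?thesis by (simp add: R_def mult.assoc continuous_on_mult)
    qed
    show "(\<lambda>_. c) \<in> R" for c
      by (simp add: R_def span_closure_scale)
    show "\<exists>f\<in>R. f x \<noteq> f y" if "x \<in> K" "y \<in> K" "x \<noteq> y" for x y
      using sep[OF that] BR by blast
  qed
  show ?thesis
  proof (rule span_closure_limit)
    fix e :: real assume "e > 0"
    then obtain g where g: "g \<in> R" "\<forall>x\<in>K. \<bar>f x - g x\<bar> < e"
      using Stone_Weierstrass_basic[OF f] by blast
    \<comment> \<open>A multiplier lies in \<open>?U\<close> itself because it can be applied to the
      constant 1.\<close>
    have "(\<lambda>x. g x * 1) \<in> ?U"
      using g(1) span_closure_base[OF unit, of K] by (auto simp: R_def dest: bspec[of ?U _ "\<lambda>x. 1"])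
    then show "\<exists>g\<in>?U. \<forall>x\<in>K. \<bar>f x - g x\<bar> < e" using g(2) by auto
  qed
qed

section \<open>Continuous functions with vanishing higher differences\<close>

definition fdiff :: "real \<Rightarrow> (real \<Rightarrow> real) \<Rightarrow> real \<Rightarrow> real" where
  "fdiff h f = (\<lambda>x. f (x + h) - f x)"

lemma fdiff_funpow_shift: "(fdiff h ^^ i) f (x + h) = (fdiff h ^^ i) f x + (fdiff h ^^ Suc i) f x"
  by (simp add: fdiff_def)

lemma fdiff_funpow_translate: "(fdiff h ^^ i) (\<lambda>x. f (x + c)) = (\<lambda>x. (fdiff h ^^ i) f (x + c))"
  by (induction i) (auto simp: fdiff_def algebra_simps)

lemma fdiff_funpow_zero_mono:
  assumes "\<And>x. (fdiff h ^^ k) f x = 0" "k \<le> i"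
  shows "(fdiff h ^^ i) f x = 0"
proof -
  have "(fdiff h ^^ (k + j)) f = (\<lambda>x. 0)" for j
  proof (induction j)
    case 0
    show ?case using assms(1) by (simp add: fun_eq_iff)
  next
    case (Suc j)
    then show ?case by (simp add: fdiff_def)
  qed
  then show ?thesis using assms(2) by (metis le_add_diff_inverse)
qed

text \<open>A shift by \<open>h\<close> is the identity plus \<open>fdiff h\<close>; the formula is
  the binomial expansion of its \<open>j\<close>-th power, with Pascal's rule as induction
  step.\<close>

lemma newton_forward:
  "f (x + real j * h) = (\<Sum>i\<le>j. real (j choose i) * (fdiff h ^^ i) f x)"
proof (induction j arbitrary: x)
  case 0
  then show ?case by simp
next
  case (Suc j)
  let ?D = "\<lambda>i. (fdiff h ^^ i) f x"
  have "f (x + real (Suc j) * h) = f ((x + h) + real j * h)"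
    by (simp add: algebra_simps)
  also have "\<dots> = (\<Sum>i\<le>j. real (j choose i) * (?D i + ?D (Suc i)))"
    unfolding Suc.IH fdiff_funpow_shift ..
  also have "\<dots> = (\<Sum>i\<le>j. real (j choose i) * ?D i) + (\<Sum>i\<le>j. real (j choose i) * ?D (Suc i))"
    by (simp add: sum.distrib distrib_left)
  also have "(\<Sum>i\<le>j. real (j choose i) * ?D i) = (\<Sum>i\<le>Suc j. real (j choose i) * ?D i)"
    by (simp add: binomial_eq_0)
  also have "\<dots> = ?D 0 + (\<Sum>i\<le>j. real (j choose Suc i) * ?D (Suc i))"
    by (subst sum.atMost_Suc_shift) simp
  also have "\<dots> + (\<Sum>i\<le>j. real (j choose i) * ?D (Suc i)) =
      ?D 0 + (\<Sum>i\<le>j. real (Suc j choose Suc i) * ?D (Suc i))"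
    by (simp add: sum.distrib distrib_right del: funpow.simps)
  also have "\<dots> = (\<Sum>i\<le>Suc j. real (Suc j choose i) * ?D i)"
    by (subst sum.atMost_Suc_shift) simp
  finally show ?case .
qed

lemma choose_eq_poly: "\<exists>q :: real poly. \<forall>j. real (j choose i) = poly q (real j)"
proof (intro exI allI)
  fix j
  show "real (j choose i) = poly (smult (1 / fact i) (\<Prod>l=0..<i. [:- real l, 1:])) (real j)"
    by (simp add: binomial_gbinomial gbinomial_prod_rev poly_prod)
qed

text \<open>The Newton expansion stops at order \<open>k\<close>, and each binomial coefficient is a
  polynomial in \<open>j\<close>. Composition with \<open>[:0, 1 / h:]\<close> changes the variable
  from \<open>j\<close> to \<open>j h\<close>.\<close>

lemma fdiff_zero_imp_poly_on_grid:
  assumes "\<And>x. (fdiff h ^^ k) f x = 0" "h \<noteq> 0"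
  shows "\<exists>p. \<forall>j::nat. f (real j * h) = poly p (real j * h)"
proof -
  obtain q where q: "\<And>i j. real (j choose i) = poly (q i) (real j)"
    using choose_eq_poly by metis
  define p where "p = (\<Sum>i<k. smult ((fdiff h ^^ i) f 0) (q i)) \<circ>\<^sub>p [:0, 1 / h:]"
  have "f (real j * h) = poly p (real j * h)" for j
  proof -
    have "f (real j * h) = (\<Sum>i\<le>j. real (j choose i) * (fdiff h ^^ i) f 0)"
      using newton_forward[of f 0 j h] by simp
    \<comment> \<open>Either of \<open>j\<close> and \<open>k\<close> may be larger, so the sum
      passes through a common range: terms with \<open>i > j\<close> vanish through the binomial,
      terms with \<open>i \<ge> k\<close> through the difference.\<close>
    also have "\<dots> = (\<Sum>i<max k (Suc j). real (j choose i) * (fdiff h ^^ i) f 0)"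
      by (intro sum.mono_neutral_left) auto
    also have "\<dots> = (\<Sum>i<k. real (j choose i) * (fdiff h ^^ i) f 0)"
      using fdiff_funpow_zero_mono[OF assms(1)] by (intro sum.mono_neutral_right) auto
    also have "\<dots> = poly p (real j * h)"
      using assms(2) by (simp add: p_def poly_pcompose poly_sum q mult.commute)
    finally show ?thesis .
  qed
  then show ?thesis by blast
qed

lemma poly_eq_if_eq_on_nat:
  fixes p q :: "real poly"
  assumes "\<And>j::nat. poly p (real j) = poly q (real j)"
  shows "p = q"
proof (rule ccontr)
  assume "p \<noteq> q"
  then have "finite {x. poly (p - q) x = 0}" by (intro poly_roots_finite) simp
  moreover have "range real \<subseteq> {x. poly (p - q) x = 0}" using assms by auto
  ultimately have "finite (range real)" using finite_subset by blast
  then show False using range_inj_infinite[of real] by (simp add: inj_on_def)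
qed

text \<open>Each mesh \<open>1 / (N + 1)\<close> yields a polynomial on its grid. All grids contain
  the naturals, so the polynomials coincide; the grids together are dense in the half line, and
  continuity does the rest.\<close>

lemma fdiff_zero_imp_poly_nonneg:
  assumes cont: "continuous_on UNIV f"
    and zero: "\<And>h x. h > 0 \<Longrightarrow> (fdiff h ^^ k) f x = 0"
  shows "\<exists>p. \<forall>x\<ge>0. f x = poly p x"
proof -
  have "\<exists>p. \<forall>j::nat. f (real j * (1 / real (Suc N))) = poly p (real j * (1 / real (Suc N)))" for N
    by (rule fdiff_zero_imp_poly_on_grid[where k = k]) (use zero in auto)
  then obtain P where P: "\<And>N j. f (real j / real (Suc N)) = poly (P N) (real j / real (Suc N))"
    by (auto simp: field_simps) metis
  have nat: "f (real j) = poly (P N) (real j)" for N j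
    using P[of "j * Suc N" N] by (simp only: of_nat_mult) (simp del: of_nat_Suc)
  then have eq: "P N = P 0" for N
    by (intro poly_eq_if_eq_on_nat) metis
  have "f x = poly (P 0) x" if x: "x \<ge> 0" for x
  proof -
    \<comment> \<open>\<open>y N\<close> rounds \<open>x\<close> down to the grid of mesh
      \<open>1 / (N + 1)\<close>.\<close>
    define y where "y N = real (nat \<lfloor>x * real (Suc N)\<rfloor>) / real (Suc N)" for N
    have "\<bar>y N - x\<bar> \<le> 1 / real (Suc N)" for N
    proof -
      have "real (nat \<lfloor>x * real (Suc N)\<rfloor>) = real_of_int \<lfloor>x * real (Suc N)\<rfloor>" using x by simp
      then have "\<bar>real (nat \<lfloor>x * real (Suc N)\<rfloor>) - x * real (Suc N)\<bar> \<le> 1" by linarith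
      then have "\<bar>real (nat \<lfloor>x * real (Suc N)\<rfloor>) - x * real (Suc N)\<bar> / real (Suc N) \<le> 1 / real (Suc N)"
        by (intro divide_right_mono) auto
      moreover have "y N - x = (real (nat \<lfloor>x * real (Suc N)\<rfloor>) - x * real (Suc N)) / real (Suc N)"
        by (simp add: y_def diff_divide_distrib del: of_nat_Suc)
      ultimately show ?thesis by (simp add: abs_divide)
    qed
    moreover have "(\<lambda>N. 1 / real (Suc N)) \<longlonglongrightarrow> 0"
      using LIMSEQ_inverse_real_of_nat by (simp add: inverse_eq_divide)
    ultimately have "(\<lambda>N. y N - x) \<longlonglongrightarrow> 0"
      by (intro Lim_null_comparison[of "\<lambda>N. y N - x" "\<lambda>N. 1 / real (Suc N)"]) auto
    then have y: "y \<longlonglongrightarrow> x" by (simp add: LIM_zero_iff)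
    have "isCont f x" using cont by (simp add: continuous_on_eq_continuous_at)
    then have "(\<lambda>N. f (y N)) \<longlonglongrightarrow> f x" using y by (rule isCont_tendsto_compose)
    moreover have "(\<lambda>N. poly (P 0) (y N)) \<longlonglongrightarrow> poly (P 0) x"
      using y by (intro isCont_tendsto_compose[OF poly_isCont])
    moreover have "f (y N) = poly (P 0) (y N)" for N
      using P[of "nat \<lfloor>x * real (Suc N)\<rfloor>" N] unfolding eq[of N] y_def .
    ultimately show ?thesis by (auto intro: LIMSEQ_unique)
  qed
  then show ?thesis by blast
qed

text \<open>Newton's formula only reaches forward from its base point, so the half-line result is
  translated to start at \<open>- T\<close>. The resulting polynomials agree on the naturals and are
  therefore one polynomial.\<close>

lemma fdiff_zero_imp_poly:
  assumes cont: "continuous_on UNIV f"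
    and zero: "\<And>h x. h > 0 \<Longrightarrow> (fdiff h ^^ k) f x = 0"
  shows "\<exists>p. \<forall>x. f x = poly p x"
proof -
  have "\<exists>p. \<forall>x\<ge>-real T. f x = poly p x" for T :: nat
  proof -
    have "\<exists>p. \<forall>x\<ge>0. f (x + - real T) = poly p x"
    proof (rule fdiff_zero_imp_poly_nonneg[where f = "\<lambda>x. f (x + - real T)"])
      show "continuous_on UNIV (\<lambda>x. f (x + - real T))"
        by (intro continuous_on_compose2[OF cont] continuous_intros) auto
      show "(fdiff h ^^ k) (\<lambda>x. f (x + - real T)) x = 0" if "h > 0" for h x
        using zero[OF that] by (simp only: fdiff_funpow_translate)
    qed
    then obtain p where p: "\<And>x. x \<ge> 0 \<Longrightarrow> f (x + - real T) = poly p x" by blast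
    have "f x = poly (p \<circ>\<^sub>p [:real T, 1:]) x" if "x \<ge> - real T" for x
      using p[of "x + real T"] that by (simp add: poly_pcompose algebra_simps)
    then show ?thesis by blast
  qed
  then obtain P where P: "\<And>(T::nat) x. x \<ge> - real T \<Longrightarrow> f x = poly (P T) x" by metis
  have "P T = P 0" for T
    by (rule poly_eq_if_eq_on_nat)
       (metis P neg_le_0_iff_le of_nat_0_le_iff order.trans minus_zero of_nat_0)
  moreover have "\<exists>T::nat. x \<ge> - real T" for x
    using real_arch_simple[of "-x"] by (auto simp: minus_le_iff)
  ultimately have "f x = poly (P 0) x" for x by (metis P)
  then show ?thesis by blast
qed

section \<open>Density of ridge functions\<close>

definition ridge :: "(real \<Rightarrow> real) \<Rightarrow> nat \<Rightarrow> ((nat \<Rightarrow> real) \<Rightarrow> real) set" where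
  "ridge \<sigma> p = {\<lambda>v. \<sigma> ((\<Sum>j<p. w j * v j) + b) |w b. True}"

definition ridge1 :: "(real \<Rightarrow> real) \<Rightarrow> (real \<Rightarrow> real) set" where
  "ridge1 \<sigma> = {\<lambda>t. \<sigma> (l * t + b) |l b. True}"

text \<open>The activation \<open>\<sigma>\<close> stays fixed while \<open>f\<close> runs through
  functions derived from it. All \<open>l\<close> and \<open>b\<close> are quantified so that one
  may average over \<open>b\<close> and form difference quotients in \<open>l\<close>.\<close>

definition monomial_dilates :: "(real \<Rightarrow> real) \<Rightarrow> nat \<Rightarrow> (real \<Rightarrow> real) \<Rightarrow> bool" where
  "monomial_dilates \<sigma> j f \<longleftrightarrow> continuous_on UNIV f \<and>
     (\<forall>R l b. (\<lambda>t. t ^ j * f (l * t + b)) \<in> span_closure (ridge1 \<sigma>) {-R..R})"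

text \<open>Mean value inequality for \<open>P z - q x * z\<close>, whose derivative is
  \<open>q z - q x\<close>.\<close>

lemma increment_bound:
  fixes P q :: "real \<Rightarrow> real"
  assumes P: "\<And>z. (P has_real_derivative q z) (at z)"
    and q: "\<And>z. z \<in> closed_segment x y \<Longrightarrow> \<bar>q z - q x\<bar> \<le> e"
  shows "\<bar>P y - P x - q x * (y - x)\<bar> \<le> e * \<bar>y - x\<bar>"
proof -
  have "norm ((P y - q x * y) - (P x - q x * x)) \<le> e * norm (y - x)"
  proof (rule field_differentiable_bound[where S = "closed_segment x y" and f' = "\<lambda>z. q z - q x"])
    show "((\<lambda>z. P z - q x * z) has_real_derivative q z - q x) (at z within closed_segment x y)" for z
      by (rule has_field_derivative_at_within) (auto intro!: derivative_eq_intros P)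
  qed (use q in auto)
  then show ?thesis by (simp add: algebra_simps)
qed

text \<open>The increment of \<open>P\<close> telescopes over \<open>N\<close> cells, and on each
  cell \<open>increment_bound\<close> compares it with the left endpoint value of
  \<open>f\<close>.\<close>

lemma riemann_sum_bound:
  fixes P f :: "real \<Rightarrow> real"
  assumes P: "\<And>z. (P has_real_derivative f z) (at z)" and N: "N > 0" and h: "h > 0"
    and f: "\<And>z w. z \<in> {x..x + h} \<Longrightarrow> w \<in> {x..x + h} \<Longrightarrow> \<bar>z - w\<bar> \<le> h / real N \<Longrightarrow> \<bar>f z - f w\<bar> \<le> e"
  shows "\<bar>P (x + h) - P x - (\<Sum>i<N. h / real N * f (x + real i * (h / real N)))\<bar> \<le> h * e"
proof -
  let ?d = "h / real N"
  let ?y = "\<lambda>i. x + real i * ?d"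
  have d: "?d > 0" using N h by simp
  have "(\<Sum>i<N. P (?y (Suc i)) - P (?y i)) = P (?y N) - P (?y 0)"
    by (rule sum_lessThan_telescope)
  then have "P (x + h) - P x - (\<Sum>i<N. ?d * f (?y i)) = (\<Sum>i<N. P (?y (Suc i)) - P (?y i) - ?d * f (?y i))"
    using N by (simp add: sum_subtractf)
  moreover have "\<bar>P (?y (Suc i)) - P (?y i) - ?d * f (?y i)\<bar> \<le> e * ?d" if i: "i < N" for i
  proof -
    have diff: "?y (Suc i) - ?y i = ?d" by (simp add: algebra_simps add_divide_distrib)
    have "real (Suc i) * ?d \<le> real N * ?d" using i d by (intro mult_right_mono) auto
    then have top: "?y (Suc i) \<le> x + h" using N by simp
    have bot: "x \<le> ?y i" using mult_nonneg_nonneg[of "real i" ?d] d by linarith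
    have "\<bar>P (?y (Suc i)) - P (?y i) - f (?y i) * (?y (Suc i) - ?y i)\<bar> \<le> e * \<bar>?y (Suc i) - ?y i\<bar>"
    proof (rule increment_bound[OF P])
      fix z assume "z \<in> closed_segment (?y i) (?y (Suc i))"
      then have "z \<in> {?y i..?y (Suc i)}" using diff d by (simp add: closed_segment_eq_real_ivl)
      then show "\<bar>f z - f (?y i)\<bar> \<le> e"
        using top bot diff by (intro f) auto
    qed
    then show ?thesis unfolding diff using d h by (simp add: mult.commute)
  qed
  then have "\<bar>\<Sum>i<N. P (?y (Suc i)) - P (?y i) - ?d * f (?y i)\<bar> \<le> (\<Sum>i<N. e * ?d)"
    by (intro order_trans[OF sum_abs] sum_mono) auto
  ultimately show ?thesis using N by (simp add: mult.commute)
qed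

lemma uniform_delta:
  fixes f :: "real \<Rightarrow> real"
  assumes "continuous_on UNIV f" "e > 0"
  obtains d where "d > 0" "\<And>z w. \<bar>z\<bar> \<le> M \<Longrightarrow> \<bar>w\<bar> \<le> M \<Longrightarrow> \<bar>z - w\<bar> < d \<Longrightarrow> \<bar>f z - f w\<bar> < e"
proof -
  have "uniformly_continuous_on {-M..M} f"
    by (intro compact_uniformly_continuous continuous_on_subset[OF assms(1)]) auto
  then obtain d where "d > 0"
      "\<And>z w. z \<in> {-M..M} \<Longrightarrow> w \<in> {-M..M} \<Longrightarrow> dist w z < d \<Longrightarrow> dist (f w) (f z) < e"
    using assms(2) unfolding uniformly_continuous_on_def by metis
  then show ?thesis
    by (intro that[of d]) (auto simp: dist_real_def abs_le_iff)
qed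

lemma affine_bound:
  fixes l t b R :: real
  assumes "\<bar>t\<bar> \<le> R"
  shows "\<bar>l * t + b\<bar> \<le> \<bar>l\<bar> * R + \<bar>b\<bar>"
  using mult_left_mono[OF assms, of "\<bar>l\<bar>"] abs_triangle_ineq[of "l * t" b] by (simp add: abs_mult)

text \<open>The new function is the integral of \<open>f\<close> over a window of length
  \<open>h\<close>. Its Riemann sums only change the offset \<open>b\<close>, so they stay in the
  closure, and they converge uniformly in \<open>t\<close>.\<close>

lemma monomial_dilates_average:
  assumes f: "monomial_dilates \<sigma> j f" and h: "h > 0"
    and P: "\<And>z. (P has_real_derivative f z) (at z)"
  shows "monomial_dilates \<sigma> j (\<lambda>x. P (x + h) - P x)"
  unfolding monomial_dilates_def
proof (intro conjI allI)
  have contP: "continuous_on UNIV P"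
    using P by (meson DERIV_isCont continuous_at_imp_continuous_on)
  show "continuous_on UNIV (\<lambda>x. P (x + h) - P x)"
    by (intro continuous_intros continuous_on_compose2[OF contP]) auto
  fix R l b :: real
  show "(\<lambda>t. t ^ j * (P (l * t + b + h) - P (l * t + b))) \<in> span_closure (ridge1 \<sigma>) {-R..R}"
  proof (rule span_closure_limit)
    fix e :: real assume e: "e > 0"
    define e' where "e' = e / ((\<bar>R\<bar> ^ j + 1) * h)"
    have R1: "\<bar>R\<bar> ^ j + 1 > 0" by (simp add: add_nonneg_pos)
    have e': "e' > 0" using e h R1 by (simp add: e'_def)
    \<comment> \<open>Every window starting at \<open>l t + b\<close> with
      \<open>\<bar>t\<bar> \<le> R\<close> lies in \<open>[-M, M]\<close>, so one modulus of
      continuity serves all \<open>t\<close>.\<close>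
    define M where "M = \<bar>l\<bar> * R + \<bar>b\<bar> + h"
    obtain d where d: "d > 0"
      "\<And>z w. \<bar>z\<bar> \<le> M \<Longrightarrow> \<bar>w\<bar> \<le> M \<Longrightarrow> \<bar>z - w\<bar> < d \<Longrightarrow> \<bar>f z - f w\<bar> < e'"
      using uniform_delta[OF _ e', of f M] f unfolding monomial_dilates_def by blast
    obtain N where N: "h / d < real N" using reals_Archimedean2 by blast
    have N0: "N > 0" using N h d(1) by (metis divide_pos_pos gr0I less_asym of_nat_0)
    have Nd: "h / real N < d" using N N0 d(1) by (simp add: field_simps)
    let ?g = "\<lambda>t. \<Sum>i<N. h / real N * (t ^ j * f (l * t + (b + real i * (h / real N))))"
    have "?g \<in> span_closure (ridge1 \<sigma>) {-R..R}"
      using f by (intro span_closure_sum) (simp add: monomial_dilates_def)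
    moreover have "\<bar>t ^ j * (P (l * t + b + h) - P (l * t + b)) - ?g t\<bar> < e" if t: "t \<in> {-R..R}" for t
    proof -
      let ?x = "l * t + b"
      let ?S = "\<Sum>i<N. h / real N * f (?x + real i * (h / real N))"
      have x: "\<bar>?x\<bar> \<le> \<bar>l\<bar> * R + \<bar>b\<bar>" using t by (intro affine_bound) auto
      have "\<bar>P (?x + h) - P ?x - ?S\<bar> \<le> h * e'"
      proof (rule riemann_sum_bound[OF P N0 h])
        fix z w assume "z \<in> {?x..?x + h}" "w \<in> {?x..?x + h}" and zw: "\<bar>z - w\<bar> \<le> h / real N"
        then have "\<bar>z\<bar> \<le> M" "\<bar>w\<bar> \<le> M" using x h unfolding M_def atLeastAtMost_iff by linarith+
        then show "\<bar>f z - f w\<bar> \<le> e'" using d(2) zw Nd by (meson le_less_trans less_imp_le)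
      qed
      moreover have "?g t = t ^ j * ?S"
        by (simp add: sum_distrib_left algebra_simps)
      ultimately have "\<bar>t ^ j * (P (?x + h) - P ?x) - ?g t\<bar> \<le> \<bar>t\<bar> ^ j * (h * e')"
        by (simp add: abs_mult power_abs mult_left_mono flip: right_diff_distrib)
      also have "\<dots> \<le> \<bar>R\<bar> ^ j * (h * e')"
        using t h e' by (intro mult_right_mono power_mono) auto
      also have "\<dots> < (\<bar>R\<bar> ^ j + 1) * (h * e')"
        using h e' by (intro mult_strict_right_mono) auto
      also have "\<dots> = e" using R1 h by (simp add: e'_def)
      finally show ?thesis .
    qed
    ultimately show "\<exists>g\<in>span_closure (ridge1 \<sigma>) {-R..R}. \<forall>t\<in>{-R..R}.
        \<bar>t ^ j * (P (l * t + b + h) - P (l * t + b)) - g t\<bar> < e"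
      by (intro bexI[of _ ?g] ballI)
  qed
qed

text \<open>Differentiating \<open>t ^ j * P (l * t + b)\<close> with respect to \<open>l\<close>
  brings down one more factor \<open>t\<close>. The difference quotients are combinations of two
  members of the closure and converge uniformly on compact intervals.\<close>

lemma monomial_dilates_deriv:
  assumes P: "monomial_dilates \<sigma> j P" and q: "continuous_on UNIV q"
    and der: "\<And>z. (P has_real_derivative q z) (at z)"
  shows "monomial_dilates \<sigma> (Suc j) q"
  unfolding monomial_dilates_def
proof (intro conjI allI)
  show "continuous_on UNIV q" by fact
  fix R l b :: real
  show "(\<lambda>t. t ^ Suc j * q (l * t + b)) \<in> span_closure (ridge1 \<sigma>) {-R..R}"
  proof (rule span_closure_limit)
    fix e :: real assume e: "e > 0"
    define e' where "e' = e / (\<bar>R\<bar> ^ Suc j + 1)"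
    have R1: "\<bar>R\<bar> ^ Suc j + 1 > 0" by (simp add: add_nonneg_pos)
    have e': "e' > 0" using e R1 by (simp add: e'_def)
    define M where "M = \<bar>l\<bar> * R + \<bar>b\<bar> + \<bar>R\<bar>"
    obtain d where d: "d > 0"
      "\<And>z w. \<bar>z\<bar> \<le> M \<Longrightarrow> \<bar>w\<bar> \<le> M \<Longrightarrow> \<bar>z - w\<bar> < d \<Longrightarrow> \<bar>q z - q w\<bar> < e'"
      using uniform_delta[OF q e'] by metis
    \<comment> \<open>The cap 1 keeps \<open>(l + s) t + b\<close> within \<open>[-M, M]\<close>;
      the other bound makes the two arguments closer than \<open>d\<close>.\<close>
    define s where "s = min 1 (d / (\<bar>R\<bar> + 1))"
    have s: "s > 0" "s \<le> 1" using d(1) by (auto simp: s_def intro!: divide_pos_pos)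
    have sR: "s * \<bar>R\<bar> < d"
    proof -
      have "s * (\<bar>R\<bar> + 1) \<le> d" using min.cobounded2[of 1 "d / (\<bar>R\<bar> + 1)"]
        by (subst (asm) pos_le_divide_eq) (auto simp: s_def)
      then show ?thesis using s(1) by (simp add: algebra_simps)
    qed
    let ?g = "\<lambda>t. 1 / s * (t ^ j * P ((l + s) * t + b)) + (- 1 / s) * (t ^ j * P (l * t + b))"
    have "?g \<in> span_closure (ridge1 \<sigma>) {-R..R}"
      using P unfolding monomial_dilates_def by (intro span_closure_add span_closure_scale) blast+
    moreover have "\<bar>t ^ Suc j * q (l * t + b) - ?g t\<bar> < e" if t: "t \<in> {-R..R}" for t
    proof -
      let ?x = "l * t + b" and ?y = "l * t + b + s * t"
      have x: "\<bar>?x\<bar> \<le> \<bar>l\<bar> * R + \<bar>b\<bar>" using t by (intro affine_bound) auto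
      have st: "\<bar>s * t\<bar> \<le> s * \<bar>R\<bar>" using t s(1) by (auto simp: abs_mult)
      have sR': "s * \<bar>R\<bar> \<le> \<bar>R\<bar>" using s by (simp add: mult_left_le_one_le)
      have "\<bar>P ?y - P ?x - q ?x * (?y - ?x)\<bar> \<le> e' * \<bar>?y - ?x\<bar>"
      proof (rule increment_bound[OF der])
        fix z assume "z \<in> closed_segment ?x ?y"
        then have z: "\<bar>z - ?x\<bar> \<le> \<bar>s * t\<bar>"
          by (auto simp: closed_segment_eq_real_ivl split: if_splits)
        then have "\<bar>z\<bar> \<le> M" "\<bar>?x\<bar> \<le> M" "\<bar>z - ?x\<bar> < d"
          using x st sR' sR unfolding M_def by linarith+
        then show "\<bar>q z - q ?x\<bar> \<le> e'" using d(2) less_imp_le by blast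
      qed
      then have incr: "\<bar>P ?y - P ?x - q ?x * (s * t)\<bar> \<le> e' * (s * \<bar>t\<bar>)"
        using s(1) by (simp add: abs_mult)
      have yx: "(l + s) * t + b = ?y" by (simp add: algebra_simps)
      have "t ^ Suc j * q ?x - ?g t = - (t ^ j / s) * (P ?y - P ?x - q ?x * (s * t))"
        unfolding yx using s(1) by (simp add: field_simps)
      then have "\<bar>t ^ Suc j * q ?x - ?g t\<bar> = \<bar>t\<bar> ^ j / s * \<bar>P ?y - P ?x - q ?x * (s * t)\<bar>"
        using s(1) by (simp add: abs_mult power_abs)
      also have "\<dots> \<le> \<bar>t\<bar> ^ j / s * (e' * (s * \<bar>t\<bar>))"
        using incr s(1) by (intro mult_left_mono) auto
      also have "\<dots> = \<bar>t\<bar> ^ Suc j * e'" using s(1) by simp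
      also have "\<dots> \<le> \<bar>R\<bar> ^ Suc j * e'"
        using t e' by (intro mult_right_mono power_mono) auto
      also have "\<dots> < (\<bar>R\<bar> ^ Suc j + 1) * e'" using e' by (intro mult_strict_right_mono) auto
      also have "\<dots> = e" using R1 by (simp add: e'_def)
      finally show ?thesis .
    qed
    ultimately show "\<exists>g\<in>span_closure (ridge1 \<sigma>) {-R..R}. \<forall>t\<in>{-R..R}.
        \<bar>t ^ Suc j * q (l * t + b) - g t\<bar> < e"
      by (intro bexI[of _ ?g] ballI)
  qed
qed

text \<open>Since \<open>f\<close> is merely continuous it cannot be differentiated directly. Its
  window integral is continuously differentiable, with derivative exactly
  \<open>fdiff h f\<close>.\<close>

lemma monomial_dilates_fdiff:
  assumes f: "monomial_dilates \<sigma> j f" and h: "h > 0"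
  shows "monomial_dilates \<sigma> (Suc j) (fdiff h f)"
proof -
  have cont: "continuous_on UNIV f" using f by (simp add: monomial_dilates_def)
  \<comment> \<open>Infinite endpoints give an antiderivative on the whole line.\<close>
  have "\<exists>P. \<forall>z. -\<infinity> < ereal z \<longrightarrow> ereal z < \<infinity> \<longrightarrow> (P has_vector_derivative f z) (at z)"
    by (rule einterval_antiderivative) (use cont in \<open>auto simp: continuous_on_eq_continuous_at\<close>)
  then obtain P where P: "\<And>z. (P has_real_derivative f z) (at z)"
    by (auto simp: has_real_derivative_iff_has_vector_derivative)
  show ?thesis
  proof (rule monomial_dilates_deriv[OF monomial_dilates_average[OF f h P]])
    show "continuous_on UNIV (fdiff h f)"
      unfolding fdiff_def by (intro continuous_intros continuous_on_compose2[OF cont]) auto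
    show "((\<lambda>x. P (x + h) - P x) has_real_derivative fdiff h f z) (at z)" for z
      unfolding fdiff_def
      by (auto intro!: derivative_eq_intros DERIV_chain2[OF P] P)
  qed
qed

lemma monomial_in_span_closure:
  assumes cont: "continuous_on UNIV \<sigma>" and npoly: "\<not> (\<exists>p. \<forall>x. \<sigma> x = poly p x)"
  shows "(\<lambda>t. t ^ k) \<in> span_closure (ridge1 \<sigma>) {-R..R}"
proof -
  \<comment> \<open>The step \<open>h\<close> depends on \<open>k\<close> and is then kept through
    all \<open>k\<close> rounds of differencing.\<close>
  obtain h x where h: "h > 0" and nz: "(fdiff h ^^ k) \<sigma> x \<noteq> 0"
    using fdiff_zero_imp_poly[OF cont] npoly by blast
  have "monomial_dilates \<sigma> k ((fdiff h ^^ k) \<sigma>)"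
  proof (induction k)
    case 0
    have "(\<lambda>t. \<sigma> (l * t + b)) \<in> ridge1 \<sigma>" for l b by (auto simp: ridge1_def)
    then show ?case using cont by (simp add: monomial_dilates_def span_closure_base)
  next
    case (Suc k)
    then show ?case using monomial_dilates_fdiff[OF _ h] by simp
  qed
  then have "(\<lambda>t. t ^ k * (fdiff h ^^ k) \<sigma> (0 * t + x)) \<in> span_closure (ridge1 \<sigma>) {-R..R}"
    unfolding monomial_dilates_def by blast
  from span_closure_scale[OF this, of "1 / (fdiff h ^^ k) \<sigma> x"] nz
  show ?thesis by simp
qed

lemma univariate_density:
  assumes "continuous_on UNIV \<sigma>" "\<not> (\<exists>p. \<forall>x. \<sigma> x = poly p x)"
    and f: "continuous_on {-R..R} f"
  shows "f \<in> span_closure (ridge1 \<sigma>) {-R..R}"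
proof -
  let ?B = "range (\<lambda>k t. t ^ k) :: (real \<Rightarrow> real) set"
  have "f \<in> span_closure ?B {-R..R}"
  proof (rule span_closure_Stone_Weierstrass)
    show "continuous_on {-R..R} p" if "p \<in> ?B" for p
      using that by (auto intro!: continuous_intros)
    show "(\<lambda>x. 1) \<in> ?B" by (rule range_eqI[of _ _ 0]) simp
    show "(\<lambda>x. p x * q x) \<in> ?B" if "p \<in> ?B" "q \<in> ?B" for p q
      using that by (auto simp flip: power_add)
    show "\<exists>p\<in>?B. p x \<noteq> p y" if "x \<noteq> y" for x y
      using that by (intro bexI[of _ "\<lambda>t. t ^ 1"]) (auto intro: range_eqI[of _ _ 1])
  qed (use f in auto)
  then show ?thesis
    by (rule span_closure_compose[where \<phi> = "\<lambda>t. t"]) (auto intro: monomial_in_span_closure[OF assms(1,2)])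
qed

section \<open>Density in several variables\<close>

lemma continuous_on_linear_form:
  "continuous_on X (\<lambda>v :: nat \<Rightarrow> real. \<Sum>j<p. w j * v j)"
  by (intro continuous_intros continuous_on_product_coordinates[THEN continuous_on_subset]) auto

text \<open>Points are functions on all naturals; \<open>inj\<close> says that the first
  \<open>p\<close> coordinates determine a point of \<open>X\<close>, which is what makes the linear
  forms separate points.\<close>

theorem ridge_density:
  assumes \<sigma>: "continuous_on UNIV \<sigma>" "\<not> (\<exists>p. \<forall>x. \<sigma> x = poly p x)"
    and X: "compact X" and inj: "\<And>v v'. v \<in> X \<Longrightarrow> v' \<in> X \<Longrightarrow> (\<And>j. j < p \<Longrightarrow> v j = v' j) \<Longrightarrow> v = v'"
    and f: "continuous_on X f"
  shows "f \<in> span_closure (ridge \<sigma> p) X"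
proof -
  let ?L = "\<lambda>w (v :: nat \<Rightarrow> real). \<Sum>j<p. w j * v j"
  let ?B = "range (\<lambda>w v. exp (?L w v)) :: ((nat \<Rightarrow> real) \<Rightarrow> real) set"
  have "f \<in> span_closure ?B X"
  proof (rule span_closure_Stone_Weierstrass)
    show "continuous_on X q" if "q \<in> ?B" for q
      using that by (auto intro!: continuous_on_exp continuous_on_linear_form)
    show "(\<lambda>x. 1) \<in> ?B" by (rule range_eqI[of _ _ "\<lambda>_. 0"]) simp
    show "(\<lambda>x. q x * r x) \<in> ?B" if "q \<in> ?B" "r \<in> ?B" for q r
    proof -
      obtain w where "q = (\<lambda>v. exp (?L w v))" using \<open>q \<in> ?B\<close> by (rule rangeE)
      moreover obtain w' where "r = (\<lambda>v. exp (?L w' v))" using \<open>r \<in> ?B\<close> by (rule rangeE)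
      ultimately show ?thesis
        by (intro range_eqI[of _ _ "\<lambda>j. w j + w' j"])
           (simp add: distrib_right sum.distrib flip: exp_add)
    qed
    show "\<exists>q\<in>?B. q x \<noteq> q y" if xy: "x \<in> X" "y \<in> X" "x \<noteq> y" for x y
    proof -
      obtain i where i: "i < p" "x i \<noteq> y i" using inj xy by blast
      have "?L (\<lambda>j. if j = i then 1 else 0) v = v i" for v
        using i(1) by (simp add: if_distrib[of "\<lambda>c. c * _"] cong: if_cong)
      then show ?thesis using i(2)
        by (intro bexI[of _ "\<lambda>v. exp (?L (\<lambda>j. if j = i then 1 else 0) v)"] rangeI) simp
    qed
  qed (use X f in auto)
  then show ?thesis
  proof (rule span_closure_compose[where \<phi> = "\<lambda>v. v"])
    fix q assume "q \<in> ?B"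
    then obtain w where q: "q = (\<lambda>v. exp (?L w v))" by blast
    \<comment> \<open>The form has bounded range on \<open>X\<close>, so \<open>exp\<close> need
      only be approximated on one interval. The inner slope \<open>l\<close> is then absorbed into
      the weights.\<close>
    have "compact (?L w ` X)"
      by (intro compact_continuous_image continuous_on_linear_form X)
    then obtain R where R: "\<And>v. v \<in> X \<Longrightarrow> \<bar>?L w v\<bar> \<le> R"
      using compact_imp_bounded by (fastforce simp: bounded_iff)
    have "exp \<in> span_closure (ridge1 \<sigma>) {-R..R}"
      by (intro univariate_density \<sigma> continuous_intros)
    then show "(\<lambda>v. q v) \<in> span_closure (ridge \<sigma> p) X"
      unfolding q
    proof (rule span_closure_compose[where \<phi> = "?L w"])
      show "?L w ` X \<subseteq> {-R..R}" using R by (auto simp: abs_le_iff minus_le_iff)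
      fix s assume "s \<in> ridge1 \<sigma>"
      then obtain l b where s: "s = (\<lambda>t. \<sigma> (l * t + b))" by (auto simp: ridge1_def)
      have "(\<lambda>v. s (?L w v)) = (\<lambda>v. \<sigma> (?L (\<lambda>j. l * w j) v + b))"
        by (simp add: s sum_distrib_left mult.assoc)
      moreover have "(\<lambda>v. \<sigma> (?L (\<lambda>j. l * w j) v + b)) \<in> ridge \<sigma> p"
        unfolding ridge_def by (intro CollectI exI[of _ "\<lambda>j. l * w j"] exI[of _ b]) simp
      ultimately have "(\<lambda>v. s (?L w v)) \<in> ridge \<sigma> p" by (simp only:)
      then show "(\<lambda>v. s (?L w v)) \<in> span_closure (ridge \<sigma> p) X" by (rule span_closure_base)
    qed
  qed auto
qed

section \<open>Stability of the solution operator and of interpolation\<close>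

text \<open>The right-hand integral \<open>\<Phi>\<close> satisfies
  \<open>\<Phi>' = c (E + k) \<le> c (\<Phi> + k)\<close>, so the integrating factor makes
  \<open>H\<close> nonincreasing from its initial value \<open>k\<close>.\<close>

lemma gronwall:
  fixes E :: "real \<Rightarrow> real"
  assumes E: "continuous_on {a..b} E" and c: "c \<ge> 0"
    and le: "\<And>x. x \<in> {a..b} \<Longrightarrow> E x \<le> integral {a..x} (\<lambda>t. c * (E t + k))"
    and x: "x \<in> {a..b}"
  shows "E x \<le> k * (exp (c * (x - a)) - 1)"
proof -
  define \<Phi> where "\<Phi> x = integral {a..x} (\<lambda>t. c * (E t + k))" for x
  define H where "H x = (\<Phi> x + k) * exp (- c * (x - a))" for x
  have der: "(\<Phi> has_real_derivative c * (E t + k)) (at t within {a..b})" if "t \<in> {a..b}" for t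
    unfolding \<Phi>_def by (rule integral_has_real_derivative) (use that in \<open>auto intro!: continuous_intros E\<close>)
  have cont: "continuous_on {a..b} \<Phi>" by (rule DERIV_continuous_on[OF der])
  have "H x \<le> H a"
  proof (rule DERIV_nonpos_imp_decreasing_open[where f = H and a = a and b = x])
    show "a \<le> x" using x by simp
    show "continuous_on {a..x} H"
    proof -
      have "continuous_on {a..x} \<Phi>"
        by (rule continuous_on_subset[OF cont]) (use x in auto)
      moreover have "continuous_on {a..x} (\<lambda>x. exp (- c * (x - a)))"
        by (intro continuous_intros)
      ultimately show ?thesis
        unfolding H_def by (intro continuous_on_mult continuous_on_add continuous_on_const)
    qed
    fix t assume t: "a < t" "t < x"
    then have "at t within {a..b} = at t" using x by (intro at_within_interior) simp
    then have "(\<Phi> has_real_derivative c * (E t + k)) (at t)"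
      using der[of t] t x by simp
    then have "(H has_real_derivative c * (E t - \<Phi> t) * exp (- c * (t - a))) (at t)"
      unfolding H_def by (auto intro!: derivative_eq_intros simp: algebra_simps)
    moreover have "c * (E t - \<Phi> t) * exp (- c * (t - a)) \<le> 0"
      using le[of t] t x c by (intro mult_nonpos_nonneg mult_nonneg_nonpos) (auto simp: \<Phi>_def)
    ultimately show "\<exists>y. (H has_real_derivative y) (at t) \<and> y \<le> 0" by blast
  qed
  then have "(\<Phi> x + k) * exp (- (c * (x - a))) \<le> k" by (simp add: H_def \<Phi>_def)
  then have "(\<Phi> x + k) * exp (- (c * (x - a))) * exp (c * (x - a)) \<le> k * exp (c * (x - a))"
    by (intro mult_right_mono) auto
  then have "\<Phi> x + k \<le> k * exp (c * (x - a))"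
    by (simp only: mult.assoc exp_minus_inverse mult_exp_exp) simp
  with le[OF x] show ?thesis by (simp add: \<Phi>_def algebra_simps)
qed

text \<open>The integrand difference is split at \<open>g (G v t) (u t) t\<close>. This mixed term
  is covered because the Lipschitz condition lets state and input values vary independently.\<close>

lemma solution_stability:
  fixes g :: "real ^ 'k \<Rightarrow> real \<Rightarrow> real \<Rightarrow> real ^ 'k"
  assumes sol: "solution_operator a b W g s0 G" and lip: "lipschitz_on_range a b W g G c"
    and c: "c \<ge> 0" and u: "u \<in> W" and v: "v \<in> W"
    and cu: "continuous_on {a..b} (G u)" and cv: "continuous_on {a..b} (G v)"
    and uv: "\<And>x. x \<in> {a..b} \<Longrightarrow> \<bar>u x - v x\<bar> \<le> k" and d: "d \<in> {a..b}"
  shows "norm (G u d - G v d) \<le> k * (exp (c * (d - a)) - 1)"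
proof (rule gronwall[where E = "\<lambda>x. norm (G u x - G v x)" and b = b])
  show cE: "continuous_on {a..b} (\<lambda>x. norm (G u x - G v x))"
    by (intro continuous_intros cu cv)
  fix x assume x: "x \<in> {a..b}"
  let ?f = "\<lambda>w t. g (G w t) (w t) t"
  have int: "?f u integrable_on {a..x}" "?f v integrable_on {a..x}"
    and eq: "G u x = s0 + integral {a..x} (?f u)" "G v x = s0 + integral {a..x} (?f v)"
    using sol u v x by (auto simp: solution_operator_def)
  have "norm (integral {a..x} (\<lambda>t. ?f u t - ?f v t)) \<le> integral {a..x} (\<lambda>t. c * (norm (G u t - G v t) + k))"
  proof (rule Henstock_Kurzweil_Integration.integral_norm_bound_integral)
    show "(\<lambda>t. ?f u t - ?f v t) integrable_on {a..x}" using int by (rule integrable_diff)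
    show "(\<lambda>t. c * (norm (G u t - G v t) + k)) integrable_on {a..x}"
      using x by (intro integrable_continuous_interval continuous_intros
        continuous_on_subset[OF cu] continuous_on_subset[OF cv]) auto
    fix t assume "t \<in> {a..x}"
    then have t: "t \<in> {a..b}" using x by auto
    have "norm (g (G u t) (u t) t - g (G v t) (u t) t) \<le> c * norm (G u t - G v t)"
      using lip t u v unfolding lipschitz_on_range_def by blast
    moreover have "norm (g (G v t) (u t) t - g (G v t) (v t) t) \<le> c * \<bar>u t - v t\<bar>"
      using lip t u v unfolding lipschitz_on_range_def by blast
    moreover have "c * \<bar>u t - v t\<bar> \<le> c * k" using uv[OF t] c by (rule mult_left_mono)
    ultimately show "norm (?f u t - ?f v t) \<le> c * (norm (G u t - G v t) + k)"
      using norm_diff_triangle_ineq[of "g (G u t) (u t) t" "g (G v t) (u t) t"]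
        norm_triangle_ineq[of "g (G u t) (u t) t - g (G v t) (u t) t" "g (G v t) (u t) t - g (G v t) (v t) t"]
      by (simp add: distrib_left)
  qed
  then show "norm (G u x - G v x) \<le> integral {a..x} (\<lambda>t. c * (norm (G u t - G v t) + k))"
    using int eq by (simp add: integral_diff)
qed (use c d in auto)

text \<open>Converts the Gronwall factor into the form \<open>y exp y\<close> of the smallness
  hypothesis on \<open>m\<close>.\<close>

lemma exp_minus_one_le: "exp y - 1 \<le> y * exp (y :: real)"
proof -
  have "(1 - y) * exp y \<le> exp (- y) * exp y"
    using exp_ge_add_one_self[of "- y"] by (intro mult_right_mono) auto
  then show ?thesis by (simp add: exp_minus algebra_simps)
qed

text \<open>On a cell the interpolant is a convex combination of two nodal values. The case
  \<open>e = 0\<close> shows that nodal values determine it on the interval.\<close>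

lemma lin_interp_diff_le:
  assumes ab: "a < b" and m: "0 < m"
    and e: "\<And>j. j \<le> m \<Longrightarrow> \<bar>u (grid a b m j) - v (grid a b m j)\<bar> \<le> e"
    and x: "x \<in> {a..b}"
  shows "\<bar>lin_interp a b m u x - lin_interp a b m v x\<bar> \<le> e"
proof -
  obtain j where j: "j < m" "grid a b m j \<le> x" "x \<le> grid a b m (Suc j)"
    using grid_cover[OF ab m] x by auto
  let ?p = "grid a b m j" and ?q = "grid a b m (Suc j)"
  define r where "r = (x - ?p) / (?q - ?p)"
  have "?p < ?q" using grid_strict_mono[OF ab m] by simp
  then have r: "0 \<le> r" "r \<le> 1" using j by (auto simp: r_def)
  have L: "lin_interp a b m w x = (1 - r) * w ?p + r * w ?q" for w
    unfolding lin_interp_cell[OF ab j] r_def by (simp add: algebra_simps diff_divide_distrib)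
  have "lin_interp a b m u x - lin_interp a b m v x = (1 - r) * (u ?p - v ?p) + r * (u ?q - v ?q)"
    unfolding L by (simp add: algebra_simps)
  also have "\<bar>\<dots>\<bar> \<le> (1 - r) * \<bar>u ?p - v ?p\<bar> + r * \<bar>u ?q - v ?q\<bar>"
    using r by (intro order_trans[OF abs_triangle_ineq]) (simp add: abs_mult)
  also have "\<dots> \<le> (1 - r) * e + r * e"
    using r j(1) by (intro add_mono mult_left_mono e) auto
  finally show ?thesis by (simp add: algebra_simps)
qed

section \<open>Evaluation and interpolation as 1-Lipschitz maps for the sup metric\<close>

lemma mdist_C_space_le:
  fixes f g :: "real \<Rightarrow> 'b::metric_space"
  assumes "a \<le> b" "f \<in> mspace (C_space a b)" "g \<in> mspace (C_space a b)"
  shows "mdist (C_space a b) f g \<le> e \<longleftrightarrow> (\<forall>x\<in>{a..b}. dist (f x) (g x) \<le> e)"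
  using assms unfolding C_space_def by (subst cfunspace_mdist_le) auto

lemma continuous_map_C_space_eval:
  assumes "x \<in> {a..b}"
  shows "continuous_map (mtopology_of (C_space a b :: (real \<Rightarrow> 'b::metric_space) metric)) euclidean (\<lambda>f. f x)"
proof -
  have "dist (f x) (g x) \<le> 1 * mdist (C_space a b) f g"
    if "f \<in> mspace (C_space a b)" "g \<in> mspace (C_space a b)" for f g :: "real \<Rightarrow> 'b"
    using mdist_C_space_le[of a b f g "mdist (C_space a b) f g"] that assms by auto
  then have "Lipschitz_continuous_map (C_space a b) euclidean_metric (\<lambda>f :: real \<Rightarrow> 'b. f x)"
    unfolding Lipschitz_continuous_map_def by (intro conjI exI[of _ 1]) auto
  from Lipschitz_continuous_imp_continuous_map[OF this] show ?thesis by simp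
qed

lemma continuous_map_lin_interp:
  assumes ab: "a < b" and m: "0 < m"
  shows "continuous_map (mtopology_of (C_space a b)) (mtopology_of (C_space a b)) (lin_interp a b m)"
proof -
  let ?L = "lin_interp a b m"
  have "mdist (C_space a b) (?L u) (?L v) \<le> 1 * mdist (C_space a b) u v"
    if uv: "u \<in> mspace (C_space a b)" "v \<in> mspace (C_space a b)" for u v
  proof -
    have "\<forall>x\<in>{a..b}. \<bar>u x - v x\<bar> \<le> mdist (C_space a b) u v"
      using mdist_C_space_le[of a b u v "mdist (C_space a b) u v"] uv ab by (auto simp: dist_real_def)
    moreover have "grid a b m j \<in> {a..b}" if "j \<le> m" for j
      using grid_mono[OF ab m, of 0 j] grid_mono[OF ab m that] by (simp add: grid_0 grid_m[OF m])
    ultimately show ?thesis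
      using ab m by (subst mult_1, subst mdist_C_space_le)
        (auto simp: dist_real_def lin_interp_in_C_space intro!: lin_interp_diff_le)
  qed
  then have "Lipschitz_continuous_map (C_space a b) (C_space a b) ?L"
    unfolding Lipschitz_continuous_map_def using lin_interp_in_C_space[OF ab m]
    by (intro conjI exI[of _ 1]) auto
  then show ?thesis by (rule Lipschitz_continuous_imp_continuous_map)
qed

section \<open>Approximation of the solution operator\<close>

lemma shallow_net_cong:
  assumes "\<And>j. j < p \<Longrightarrow> v j = v' j"
  shows "shallow_net \<sigma> n p W1 b1 W2 b2 v = shallow_net \<sigma> n p W1 b1 W2 b2 v'"
  using assms by (simp add: shallow_net_def)

text \<open>Components are approximated separately. The hidden layer collects the neurons of all of
  them, and the output row of \<open>k\<close> is zero on neurons foreign to \<open>k\<close>; the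
  output bias is 0.\<close>

theorem shallow_net_density:
  fixes F :: "(nat \<Rightarrow> real) \<Rightarrow> real ^ 'k"
  assumes \<sigma>: "continuous_on UNIV \<sigma>" "\<not> (\<exists>p. \<forall>x. \<sigma> x = poly p x)"
    and X: "compact X" and inj: "\<And>v v'. v \<in> X \<Longrightarrow> v' \<in> X \<Longrightarrow> (\<And>j. j < p \<Longrightarrow> v j = v' j) \<Longrightarrow> v = v'"
    and F: "continuous_on X F" and e: "e > 0"
  shows "\<exists>n\<ge>1. \<exists>W1 b1 W2 b2. \<forall>v\<in>X. norm (F v - shallow_net \<sigma> n p W1 b1 W2 b2 v) < e"
proof -
  \<comment> \<open>The Euclidean norm is bounded by the sum of the component errors.\<close>
  define \<eta> where "\<eta> = e / real CARD('k)"
  have \<eta>: "\<eta> > 0" using e by (simp add: \<eta>_def)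
  define approx where "approx k P C \<longleftrightarrow> finite P \<and> P \<subseteq> ridge \<sigma> p \<and>
    (\<forall>v\<in>X. \<bar>F v $ k - (\<Sum>q\<in>P. C q * q v)\<bar> < \<eta>)" for k P C
  have "\<exists>P C. approx k P C" for k
  proof -
    have "(\<lambda>v. F v $ k) \<in> span_closure (ridge \<sigma> p) X"
    proof (rule ridge_density[OF \<sigma> X])
      show "continuous_on X (\<lambda>v. F v $ k)" using F by (rule continuous_on_component)
    qed (rule inj)
    then show ?thesis using \<eta> by (simp add: span_closure_def approx_def)
  qed
  then obtain P C where "\<And>k. approx k (P k) (C k)" by metis
  then have P: "\<And>k. finite (P k)" "\<And>k. P k \<subseteq> ridge \<sigma> p"
    and C: "\<And>k v. v \<in> X \<Longrightarrow> \<bar>F v $ k - (\<Sum>q\<in>P k. C k q * q v)\<bar> < \<eta>"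
    by (simp_all add: approx_def)
  \<comment> \<open>A dummy neuron ensures positive width even if every \<open>P k\<close> is
    empty.\<close>
  define r0 where "r0 = (\<lambda>v :: nat \<Rightarrow> real. \<sigma> ((\<Sum>j<p. 0 * v j) + 0))"
  have r0: "r0 \<in> ridge \<sigma> p"
    unfolding ridge_def r0_def by (intro CollectI exI[of _ "\<lambda>_. 0"] exI[of _ 0]) simp
  define N where "N = insert r0 (\<Union>k. P k)"
  have finN: "finite N" and PN: "\<And>k. P k \<subseteq> N" and N: "N \<subseteq> ridge \<sigma> p"
    using P r0 by (auto simp: N_def)
  define n where "n = card N"
  have n: "n \<ge> 1" using finN by (simp add: n_def N_def Suc_le_eq card_gt_0_iff)
  obtain h where h: "bij_betw h {..<n} N"
    using ex_bij_betw_nat_finite[OF finN] by (auto simp: n_def atLeast0LessThan)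
  define neuron where "neuron w b = (\<lambda>v. \<sigma> ((\<Sum>j<p. w j * v j) + b))" for w b
  \<comment> \<open>Elements of \<open>N\<close> are bare functions; weights and a bias realising
    each of them are chosen here.\<close>
  have "\<exists>w b. q = neuron w b" if "q \<in> N" for q
    using that N by (auto simp: ridge_def neuron_def)
  then obtain w b where wb: "\<And>q. q \<in> N \<Longrightarrow> q = neuron (w q) (b q)" by metis
  define W2 where "W2 k i = (if h i \<in> P k then C k (h i) else 0)" for k i
  let ?net = "shallow_net \<sigma> n p (\<lambda>i. w (h i)) (\<lambda>i. b (h i)) W2 0"
  have net: "?net v $ k = (\<Sum>q\<in>P k. C k q * q v)" for v k
  proof -
    have "?net v $ k = (\<Sum>i<n. W2 k i * h i v)"
    proof -
      have "h i v = \<sigma> ((\<Sum>j<p. w (h i) j * v j) + b (h i))" if "i < n" for i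
        using fun_cong[OF wb, of "h i" v] bij_betwE[OF h] that by (simp add: neuron_def)
      then show ?thesis by (simp add: shallow_net_def)
    qed
    also have "\<dots> = (\<Sum>q\<in>N. (if q \<in> P k then C k q else 0) * q v)"
      unfolding W2_def by (rule sum.reindex_bij_betw[OF h])
    also have "\<dots> = (\<Sum>q\<in>P k. C k q * q v)"
      using finN PN by (intro sum.mono_neutral_cong_right) auto
    finally show ?thesis .
  qed
  have "norm (F v - ?net v) < e" if v: "v \<in> X" for v
  proof -
    have "norm (F v - ?net v) \<le> (\<Sum>k\<in>UNIV. \<bar>(F v - ?net v) $ k\<bar>)" by (rule norm_le_l1_cart)
    also have "\<dots> < (\<Sum>k\<in>(UNIV :: 'k set). \<eta>)"
      using C[OF v] by (intro sum_strict_mono) (auto simp: net)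
    also have "\<dots> = e" by (simp add: \<eta>_def)
    finally show ?thesis .
  qed
  with n show ?thesis by (intro exI conjI ballI)
qed

theorem theorem2:
  fixes a b c \<epsilon> :: real
    and V :: "(real \<Rightarrow> real) set"
    and s0 :: "real ^ 'k"
    and g :: "real ^ 'k \<Rightarrow> real \<Rightarrow> real \<Rightarrow> real ^ 'k"
    and G :: "(real \<Rightarrow> real) \<Rightarrow> real \<Rightarrow> real ^ 'k"
    and \<sigma> :: "real \<Rightarrow> real"
    and \<kappa> :: "nat \<Rightarrow> real"
    and m :: nat
  assumes "a < b"
    and "compactin (mtopology_of (C_space a b)) V"
    and "continuous_map (subtopology (mtopology_of (C_space a b)) (W_set a b V))
           (mtopology_of (C_space a b)) G"
    and "solution_operator a b (W_set a b V) g s0 G"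
    and "c > 0"
    and "lipschitz_on_range a b (W_set a b V) g G c"
    and "continuous_on UNIV \<sigma>"
    and "\<not> (\<exists>p :: real poly. \<forall>x. \<sigma> x = poly p x)"
    and "\<And>k u x. k \<ge> 1 \<Longrightarrow> u \<in> V \<Longrightarrow> x \<in> {a..b} \<Longrightarrow> \<bar>u x - lin_interp a b k u x\<bar> \<le> \<kappa> k"
    and "\<kappa> \<longlonglongrightarrow> 0"
    and "\<epsilon> > 0"
    and "m \<ge> 1"
    and "c * (b - a) * \<kappa> m * exp (c * (b - a)) < \<epsilon>"
  shows "\<forall>d\<in>{a..b}. \<exists>n \<ge> 1. \<exists>(W1 :: nat \<Rightarrow> nat \<Rightarrow> real) (b1 :: nat \<Rightarrow> real)
           (W2 :: 'k \<Rightarrow> nat \<Rightarrow> real) (b2 :: real ^ 'k).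
           \<forall>u\<in>V. norm (G u d - shallow_net \<sigma> n (m + 1) W1 b1 W2 b2 (\<lambda>j. u (grid a b m j))) < \<epsilon>"
proof
  fix d assume d: "d \<in> {a..b}"
  note ab = \<open>a < b\<close> and m = \<open>m \<ge> 1\<close>
  have m0: "0 < m" using m by simp
  let ?C = "mtopology_of (C_space a b) :: (real \<Rightarrow> real) topology"
  let ?W = "W_set a b V" and ?L = "lin_interp a b m"
  have VC: "V \<subseteq> mspace (C_space a b)"
    using compactin_subset_topspace[OF assms(2)] by simp
  have VW: "V \<subseteq> ?W" unfolding W_set_def W_level_def by auto
  \<comment> \<open>Because interpolants belong to \<open>W\<close>, the operator, its integral
    equation and the Lipschitz bound all apply to them.\<close>
  have LW: "?L u \<in> ?W" if "u \<in> V" for u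
    using that m unfolding W_set_def W_level_def U_set_def by auto
  have contG: "continuous_on {a..b} (G u)" if "u \<in> ?W" for u
  proof -
    have "G u \<in> mspace (C_space a b)"
      using continuous_map_image_subset_topspace[OF assms(3)] that
        W_set_subset_C_space[OF ab VC] by auto
    then show ?thesis by (simp add: in_C_space_iff)
  qed
  have grid_in: "grid a b m j \<in> {a..b}" if "j \<le> m" for j
    using grid_mono[OF ab m0, of 0 j] grid_mono[OF ab m0 that] by (simp add: grid_0 grid_m[OF m0])

  let ?T = "subtopology ?C V"
  \<comment> \<open>Nodal vector with \<open>m + 1\<close> entries, padded by 0 so that these
    entries determine it as a function on the naturals.\<close>
  define \<pi> where "\<pi> u = (\<lambda>j. if j < m + 1 then u (grid a b m j) else 0)" for u :: "real \<Rightarrow> real"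
  define X where "X = \<pi> ` V"
  have topT: "topspace ?T = V" using VC by auto
  have "continuous_map ?T euclidean (\<lambda>u. \<pi> u j)" for j
  proof (cases "j < m + 1")
    case True
    then have "continuous_map ?C euclidean (\<lambda>u. u (grid a b m j))"
      by (intro continuous_map_C_space_eval grid_in) simp
    then show ?thesis using True by (simp add: \<pi>_def continuous_map_from_subtopology)
  qed (simp add: \<pi>_def)
  then have cont_\<pi>: "continuous_map ?T euclidean \<pi>"
    by (simp add: continuous_map_componentwise_UNIV flip: euclidean_product_topology)
  then have \<pi>: "continuous_map ?T (top_of_set X) \<pi>"
    by (simp add: continuous_map_in_subtopology topT X_def)
  have compT: "compact_space ?T" by (rule compact_space_subtopology[OF assms(2)])
  \<comment> \<open>A continuous map from a compact to a Hausdorff space is closed, so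
    \<open>\<pi>\<close> is a quotient map onto \<open>X\<close>. Continuous functions on
    \<open>V\<close> that are constant on its fibres thus descend continuously to
    \<open>X\<close>.\<close>
  have "closed_map ?T (top_of_set X) \<pi>"
    by (intro continuous_imp_closed_map_gen[OF compT _ \<pi>] Hausdorff_imp_kc_space
      Hausdorff_space_subtopology Hausdorff_space_euclidean)
  then have quot: "quotient_map ?T (top_of_set X) \<pi>"
    by (rule continuous_closed_imp_quotient_map[OF \<pi>])
       (simp only: topT X_def topspace_euclidean_subtopology)
  have X: "compact X"
  proof -
    have "compactin ?T V" using assms(2) by (simp add: compactin_subtopology)
    then have "compactin euclidean (\<pi> ` V)" using cont_\<pi> by (rule image_compactin)
    then show ?thesis by (simp add: X_def)
  qed

  have "continuous_map ?T (subtopology ?C ?W) ?L"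
    using continuous_map_lin_interp[OF ab m0] LW
    by (auto simp: continuous_map_in_subtopology topT continuous_map_from_subtopology)
  then have "continuous_map ?T (mtopology_of (C_space a b)) (G \<circ> ?L)"
    using assms(3) by (rule continuous_map_compose)
  then have cont_h: "continuous_map ?T euclidean ((\<lambda>f. f d) \<circ> (G \<circ> ?L))"
    using continuous_map_C_space_eval[OF d] by (rule continuous_map_compose)
  \<comment> \<open>Equal nodal values give the same interpolant as a function: off the interval
    both are \<open>undefined\<close>, so \<open>G\<close> receives identical arguments.\<close>
  have h_eq: "((\<lambda>f. f d) \<circ> (G \<circ> ?L)) u = ((\<lambda>f. f d) \<circ> (G \<circ> ?L)) v" if "\<pi> u = \<pi> v" for u v
  proof -
    have "u (grid a b m j) = v (grid a b m j)" if "j \<le> m" for j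
      using fun_cong[OF \<open>\<pi> u = \<pi> v\<close>, of j] that by (simp add: \<pi>_def)
    then have "?L u x = ?L v x" if "x \<in> {a..b}" for x
      using lin_interp_diff_le[OF ab m0 _ that, of u v 0] by simp
    moreover have "?L u x = ?L v x" if "x \<notin> {a..b}" for x
      using that unfolding lin_interp_def by (simp only: restrict_apply if_False)
    ultimately have "?L u = ?L v" by (intro ext) (metis (no_types))
    then show ?thesis by simp
  qed
  obtain F where F: "continuous_map (top_of_set X) euclidean F"
    and "\<And>u. u \<in> topspace ?T \<Longrightarrow> F (\<pi> u) = ((\<lambda>f. f d) \<circ> (G \<circ> ?L)) u"
    by (rule quotient_map_lift_exists[OF quot cont_h h_eq]) (assumption, rule that)
  then have F\<pi>: "F (\<pi> u) = G (?L u) d" if "u \<in> V" for u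
    using that unfolding topT by simp

  \<comment> \<open>The slack left after the interpolation error is the tolerance for the
    network.\<close>
  define \<delta> where "\<delta> = \<epsilon> - c * (b - a) * \<kappa> m * exp (c * (b - a))"
  have \<delta>: "\<delta> > 0" using assms(13) by (simp add: \<delta>_def)
  have "\<exists>n\<ge>1. \<exists>W1 b1 W2 b2. \<forall>v\<in>X. norm (F v - shallow_net \<sigma> n (m + 1) W1 b1 W2 b2 v) < \<delta>"
  proof (rule shallow_net_density[OF assms(7,8) X _ _ \<delta>])
    show "continuous_on X F" using F by simp
    show "v = v'" if "v \<in> X" "v' \<in> X" "\<And>j. j < m + 1 \<Longrightarrow> v j = v' j" for v v'
      using that unfolding X_def \<pi>_def by fastforce
  qed
  then obtain n W1 b1 W2 b2 where n: "n \<ge> 1"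
    and net: "\<And>v. v \<in> X \<Longrightarrow> norm (F v - shallow_net \<sigma> n (m + 1) W1 b1 W2 b2 v) < \<delta>" by blast
  have "norm (G u d - shallow_net \<sigma> n (m + 1) W1 b1 W2 b2 (\<lambda>j. u (grid a b m j))) < \<epsilon>" if u: "u \<in> V" for u
  proof -
    \<comment> \<open>The sign follows from the error bound at the given \<open>u\<close> and
      \<open>d\<close>, and is needed to multiply the exponential estimates below.\<close>
    have \<kappa>: "\<kappa> m \<ge> 0" using assms(9)[OF m u d] by linarith
    have "norm (G u d - G (?L u) d) \<le> \<kappa> m * (exp (c * (d - a)) - 1)"
      using u VW LW[OF u] assms(5) d
      by (intro solution_stability[OF assms(4,6)] contG assms(9)[OF m]) auto
    also have "\<dots> \<le> \<kappa> m * (exp (c * (b - a)) - 1)"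
      using \<kappa> assms(5) d by (intro mult_left_mono) auto
    also have "\<dots> \<le> \<kappa> m * (c * (b - a) * exp (c * (b - a)))"
      using \<kappa> by (intro mult_left_mono exp_minus_one_le)
    finally have "norm (G u d - G (?L u) d) \<le> \<epsilon> - \<delta>" by (simp add: \<delta>_def mult_ac)
    moreover have "norm (G (?L u) d - shallow_net \<sigma> n (m + 1) W1 b1 W2 b2 (\<lambda>j. u (grid a b m j))) < \<delta>"
    proof -
      have "shallow_net \<sigma> n (m + 1) W1 b1 W2 b2 (\<lambda>j. u (grid a b m j)) =
          shallow_net \<sigma> n (m + 1) W1 b1 W2 b2 (\<pi> u)"
        by (rule shallow_net_cong) (simp add: \<pi>_def)
      then show ?thesis using net[of "\<pi> u"] F\<pi>[OF u] u by (simp add: X_def)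
    qed
    ultimately show ?thesis
      using norm_triangle_ineq[of "G u d - G (?L u) d"
        "G (?L u) d - shallow_net \<sigma> n (m + 1) W1 b1 W2 b2 (\<lambda>j. u (grid a b m j))"] by simp
  qed
  with n show "\<exists>n \<ge> 1. \<exists>W1 b1 W2 b2.
     \<forall>u\<in>V. norm (G u d - shallow_net \<sigma> n (m + 1) W1 b1 W2 b2 (\<lambda>j. u (grid a b m j))) < \<epsilon>"
    by (intro exI conjI ballI)
qed

end
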